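(* Suppose that the problem $\min\{g(x)+f(w): Ax+Bw=b\}$ satisfies the standing assumption, and let $(\bar x,\bar w,\bar y)$ be a saddle point of $\mathbb{L}$. Let the sequence $\{(x_k,w_k,y_k)\}_{k\ge 1}$ be generated by Algorithm 1 (described in the context). Then $\{(x_k,w_k,y_k)\}_{k\ge1}$ converges to a saddle point of $\mathbb{L}$.
   Context: **Problem.** $g:\mathbb{R}^q\to\mathbb{R}\cup\{+\infty\}$ and $f:\mathbb{R}^p\to\mathbb{R}\cup\{+\infty\}$ are proper, closed, convex functions, $A\in\mathbb{R}^{m\times q}$, $B\in\mathbb{R}^{m\times p}$, $b\in\mathbb{R}^m$. The problem is $\min_{x\in\mathbb{R}^q,\,w\in\mathbb{R}^p} g(x)+f(w)$ subject to $Ax+Bw=b$. Set $\Phi(x,w):=g(x)+f(w)$, $\mathbb{L}(x,w,y):=\Phi(x,w)+\langle y,Ax+Bw-b\rangle$ and, for $\sigma>0$, $\mathbb{L}_\sigma(x,w,y):=\mathbb{L}(x,w,y)+\frac{\sigma}{2}\|Ax+Bw-b\|^2$. A triple $(x^\star,w^\star,y^\star)$ is a saddle point of $\mathbb{L}$ if $\mathbb{L}(x^\star,w^\star,y)\le\mathbb{L}(x^\star,w^\star,y^\star)\le\mathbb{L}(x,w,y^\star)$ for all $(x,w,y)\in\mathbb{R}^q\times\mathbb{R}^p\times\mathbb{R}^m$. **Standing assumption.** The solution set of the problem is nonempty, and there exist $\tilde x\in\operatorname{ri}(\operatorname{dom} g)$ and $\tilde w\in\operatorname{ri}(\operatorname{dom}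 f)$ with $A\tilde x+B\tilde w=b$ ($\operatorname{ri}$ = relative interior). **Notation.** $\|\cdot\|$ is the Euclidean norm. For a symmetric positive semidefinite $M$, $\|y\|_M:=\sqrt{y^\top My}$. $\lambda_{\min}(M)$ is the smallest eigenvalue of $M$. $\varphi:=\frac{1+\sqrt5}{2}$. **Algorithm 1.** Let $S\in\mathbb{R}^{q\times q}$ and $T\in\mathbb{R}^{p\times p}$ be symmetric positive definite, $x_0\in\mathbb{R}^q$, $w_0\in\mathbb{R}^p$, $y_0\in\mathbb{R}^m$, $u_0=x_0$, $\tau_0>0$, $\beta>0$, $\psi\in(1,\varphi]$, $0<\mu<\frac{\psi}{2}$. For $k=1,2,\dots$: $$u_k=\tfrac{\psi-1}{\psi}x_{k-1}+\tfrac1\psi u_{k-1},\qquad x_k=\arg\min_x\Big\{\mathbb{L}(x,w_{k-1},y_{k-1})+\tfrac{1}{2\tau_{k-1}}\|x-u_k\|_S^2\Big\},$$ $$\tau_k=\min\Big\{\tau_{k-1},\frac{\mu\sqrt{\lambda_{\min}(S)}}{\sqrt\beta\,L_k}\Big\},\qquad L_k:=\frac{\|Ax_k-Ax_{k-1}\|}{\|x_k-x_{k-1}\|},$$ with the convention that $\tau_k=\tau_{k-1}$ whenever $Ax_k=Ax_{k-1}$ (in particular whenever $x_k=x_{k-1}$), $$w_k=\arg\min_w\Big\{\mathbb{L}_{\beta\tau_k}(x_k,w,y_{k-1})+\tfrac12\|w-w_{k-1}\|_T^2\Big\},\qquad y_k=y_{k-1}+\beta\tau_k(Ax_k+Bw_k-b).$$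 *)

theory Defs
  imports "HOL-Analysis.Analysis"
begin

definition epi :: "('a \<Rightarrow> ereal) \<Rightarrow> ('a \<times> real) set" where
  "epi h = {(z, r). h z \<le> ereal r}"

definition dom :: "('a \<Rightarrow> ereal) \<Rightarrow> 'a set" where
  "dom h = {z. h z < \<infinity>}"

definition proper :: "('a \<Rightarrow> ereal) \<Rightarrow> bool" where
  "proper h \<longleftrightarrow> (\<forall>z. h z \<noteq> -\<infinity>) \<and> dom h \<noteq> {}"

definition proper_closed_convex :: "('a::euclidean_space \<Rightarrow> ereal) \<Rightarrow> bool" where
  "proper_closed_convex h \<longleftrightarrow> proper h \<and> closed (epi h) \<and> convex (epi h)"

definition sym_pos_def :: "real^'n^'n \<Rightarrow> bool" where
  "sym_pos_def M \<longleftrightarrow> transpose M = M \<and> (\<forall>v. v \<noteq> 0 \<longrightarrow> 0 < v \<bullet> (M *v v))"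

definition mnorm :: "real^'n^'n \<Rightarrow> real^'n \<Rightarrow> real" where
  "mnorm M v = sqrt (v \<bullet> (M *v v))"

definition eigval :: "real^'n^'n \<Rightarrow> real \<Rightarrow> bool" where
  "eigval M l \<longleftrightarrow> (\<exists>v. v \<noteq> 0 \<and> M *v v = l *\<^sub>R v)"

(* Meaningful for symmetric M, which has a nonempty finite set of real eigenvalues. *)
definition lambda_min :: "real^'n^'n \<Rightarrow> real" where
  "lambda_min M = (LEAST l. eigval M l)"

definition golden :: real where
  "golden = (1 + sqrt 5) / 2"

definition Phi :: "('a \<Rightarrow> ereal) \<Rightarrow> ('b \<Rightarrow> ereal) \<Rightarrow> 'a \<Rightarrow> 'b \<Rightarrow> ereal" where
  "Phi g f x w = g x + f w"

definition lagrangian ::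
  "(real^'q \<Rightarrow> ereal) \<Rightarrow> (real^'p \<Rightarrow> ereal) \<Rightarrow> real^'q^'m \<Rightarrow> real^'p^'m \<Rightarrow> real^'m \<Rightarrow>
    real^'q \<Rightarrow> real^'p \<Rightarrow> real^'m \<Rightarrow> ereal" where
  "lagrangian g f A B b x w y = Phi g f x w + ereal (y \<bullet> (A *v x + B *v w - b))"

definition aug_lagrangian ::
  "(real^'q \<Rightarrow> ereal) \<Rightarrow> (real^'p \<Rightarrow> ereal) \<Rightarrow> real^'q^'m \<Rightarrow> real^'p^'m \<Rightarrow> real^'m \<Rightarrow> real \<Rightarrow>
    real^'q \<Rightarrow> real^'p \<Rightarrow> real^'m \<Rightarrow> ereal" where
  "aug_lagrangian g f A B b \<sigma> x w y =
     lagrangian g f A B b x w y + ereal (\<sigma> / 2 * (norm (A *v x + B *v w - b))\<^sup>2)"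

definition saddle_point ::
  "(real^'q \<Rightarrow> ereal) \<Rightarrow> (real^'p \<Rightarrow> ereal) \<Rightarrow> real^'q^'m \<Rightarrow> real^'p^'m \<Rightarrow> real^'m \<Rightarrow>
    real^'q \<Rightarrow> real^'p \<Rightarrow> real^'m \<Rightarrow> bool" where
  "saddle_point g f A B b xs ws ys \<longleftrightarrow>
     (\<forall>x w y. lagrangian g f A B b xs ws y \<le> lagrangian g f A B b xs ws ys \<and>
              lagrangian g f A B b xs ws ys \<le> lagrangian g f A B b x w ys)"

definition solution ::
  "(real^'q \<Rightarrow> ereal) \<Rightarrow> (real^'p \<Rightarrow> ereal) \<Rightarrow> real^'q^'m \<Rightarrow> real^'p^'m \<Rightarrow> real^'m \<Rightarrow>
    real^'q \<Rightarrow> real^'p \<Rightarrow> bool" where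
  "solution g f A B b xs ws \<longleftrightarrow>
     is_arg_min (\<lambda>(x, w). Phi g f x w) (\<lambda>(x, w). A *v x + B *v w = b) (xs, ws)"

definition standing_assumption ::
  "(real^'q \<Rightarrow> ereal) \<Rightarrow> (real^'p \<Rightarrow> ereal) \<Rightarrow> real^'q^'m \<Rightarrow> real^'p^'m \<Rightarrow> real^'m \<Rightarrow> bool" where
  "standing_assumption g f A B b \<longleftrightarrow>
     (\<exists>x w. solution g f A B b x w) \<and>
     (\<exists>x\<in>rel_interior (dom g). \<exists>w\<in>rel_interior (dom f). A *v x + B *v w = b)"

(* The objective of the x-subproblem.  The term f(w) of the Lagrangian does not depend on x and is
   omitted (f is replaced by 0): the starting point w 0 may lie outside dom f, where the full
   Lagrangian would be identically infinite and every x would minimise it.  For w in dom f the two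
   objectives have the same minimisers (is_arg_min_x_objective_iff). *)
definition x_objective ::
  "(real^'q \<Rightarrow> ereal) \<Rightarrow> real^'q^'m \<Rightarrow> real^'p^'m \<Rightarrow> real^'m \<Rightarrow> real^'q^'q \<Rightarrow> real \<Rightarrow>
    real^'q \<Rightarrow> real^'p \<Rightarrow> real^'m \<Rightarrow> real^'q \<Rightarrow> ereal" where
  "x_objective g A B b S t u w y x =
     lagrangian g (\<lambda>_. 0) A B b x w y + ereal (1 / (2 * t) * (mnorm S (x - u))\<^sup>2)"

lemma is_arg_min_x_objective_iff:
  fixes f :: "real^'p \<Rightarrow> ereal"
  assumes "f w \<noteq> -\<infinity>" and "w \<in> dom f"
  shows "is_arg_min (x_objective g A B b S t u w y) (\<lambda>_. True) x \<longleftrightarrow>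
         is_arg_min (\<lambda>x. lagrangian g f A B b x w y + ereal (1 / (2 * t) * (mnorm S (x - u))\<^sup>2))
           (\<lambda>_. True) x"
proof -
  from assms obtain r where r: "f w = ereal r"
    by (cases "f w") (auto simp: dom_def)
  have "lagrangian g f A B b x w y + ereal (1 / (2 * t) * (mnorm S (x - u))\<^sup>2) =
        x_objective g A B b S t u w y x + ereal r" for x
    by (cases "g x") (auto simp: x_objective_def lagrangian_def Phi_def r)
  moreover have "a + ereal r < c + ereal r \<longleftrightarrow> a < c" for a c :: ereal
    by (cases a; cases c) auto
  ultimately show ?thesis
    by (simp add: is_arg_min_def)
qed

definition w_objective ::
  "(real^'q \<Rightarrow> ereal) \<Rightarrow> (real^'p \<Rightarrow> ereal) \<Rightarrow> real^'q^'m \<Rightarrow> real^'p^'m \<Rightarrow> real^'m \<Rightarrow>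
    real^'p^'p \<Rightarrow> real \<Rightarrow> real^'p \<Rightarrow> real^'q \<Rightarrow> real^'m \<Rightarrow> real^'p \<Rightarrow> ereal" where
  "w_objective g f A B b T \<sigma> w' x y w =
     aug_lagrangian g f A B b \<sigma> x w y + ereal (1 / 2 * (mnorm T (w - w'))\<^sup>2)"

definition local_lipschitz :: "real^'q^'m \<Rightarrow> real^'q \<Rightarrow> real^'q \<Rightarrow> real" where
  "local_lipschitz A x x' = norm (A *v x - A *v x') / norm (x - x')"

definition algorithm1 ::
  "(real^'q \<Rightarrow> ereal) \<Rightarrow> (real^'p \<Rightarrow> ereal) \<Rightarrow> real^'q^'m \<Rightarrow> real^'p^'m \<Rightarrow> real^'m \<Rightarrow>
    real^'q^'q \<Rightarrow> real^'p^'p \<Rightarrow> real \<Rightarrow> real \<Rightarrow> real \<Rightarrow>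
    (nat \<Rightarrow> real^'q) \<Rightarrow> (nat \<Rightarrow> real^'q) \<Rightarrow> (nat \<Rightarrow> real) \<Rightarrow>
    (nat \<Rightarrow> real^'p) \<Rightarrow> (nat \<Rightarrow> real^'m) \<Rightarrow> bool" where
  "algorithm1 g f A B b S T \<beta> \<psi> \<mu> u x \<tau> w y \<longleftrightarrow>
     u 0 = x 0 \<and>
     (\<forall>k\<ge>1.
        u k = ((\<psi> - 1) / \<psi>) *\<^sub>R x (k - 1) + (1 / \<psi>) *\<^sub>R u (k - 1) \<and>
        is_arg_min (x_objective g A B b S (\<tau> (k - 1)) (u k) (w (k - 1)) (y (k - 1)))
          (\<lambda>_. True) (x k) \<and>
        \<tau> k = (if A *v x k = A *v x (k - 1) then \<tau> (k - 1)
               else min (\<tau> (k - 1))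
                 (\<mu> * sqrt (lambda_min S) / (sqrt \<beta> * local_lipschitz A (x k) (x (k - 1))))) \<and>
        is_arg_min (w_objective g f A B b T (\<beta> * \<tau> k) (w (k - 1)) (x k) (y (k - 1)))
          (\<lambda>_. True) (w k) \<and>
        y k = y (k - 1) + (\<beta> * \<tau> k) *\<^sub>R (A *v x k + B *v w k - b))"

end

theory Submission
  imports Defs
begin

text \<open>
  For a saddle point \<open>(a, c, d)\<close>, the optimality conditions of the two subproblems show that
  \<open>\<psi> / (\<psi> - 1) \<parallel>u\<^sub>k\<^sub>+\<^sub>1 - a\<parallel>\<^sub>S\<^sup>2 + \<tau>\<^sub>k\<^sub>-\<^sub>1 \<parallel>w\<^sub>k\<^sub>-\<^sub>1 - c\<parallel>\<^sub>T\<^sup>2 + \<parallel>y\<^sub>k\<^sub>-\<^sub>1 - d\<parallel>\<^sup>2 / \<beta>\<close> decreases, up to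
  factors depending on ratios of consecutive step sizes, by a positive combination of the squared
  increments of the iterates. The step sizes decrease to a positive limit, so the ratios tend to 1 and
  the decrease is eventually genuine. Hence the iterates are bounded with vanishing increments, every
  cluster point is a saddle point by closedness of the epigraphs, and applying the monotonicity once
  more with a cluster point in place of \<open>(a, c, d)\<close> gives convergence of the whole sequence.
\<close>

section \<open>Quadratic forms of positive definite matrices\<close>

abbreviation qform :: "real^'n^'n \<Rightarrow> real^'n \<Rightarrow> real" where
  "qform M v \<equiv> v \<bullet> (M *v v)"

text \<open>Dividing by \<open>s\<close> and letting \<open>s\<close> tend to 0 from the right
  leaves \<open>a\<close>. This is how first-order conditions are extracted from minimality along a
  segment.\<close>

lemma linear_term_nonneg:
  fixes a c :: real
  assumes "\<And>s. 0 < s \<Longrightarrow> s \<le> 1 \<Longrightarrow> 0 \<le> s * a + s\<^sup>2 * c"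
  shows "0 \<le> a"
proof (rule tendsto_lowerbound)
  show "((\<lambda>s. a + s * c) \<longlongrightarrow> a) (at_right 0)"
    by (auto intro!: tendsto_eq_intros)
  have "0 \<le> a + s * c" if "0 < s" "s < 1" for s
  proof -
    have "0 \<le> s * (a + s * c)"
      using assms[of s] that by (simp add: power2_eq_square algebra_simps)
    with that show ?thesis by (simp add: zero_le_mult_iff)
  qed
  then show "\<forall>\<^sub>F s in at_right 0. 0 \<le> a + s * c"
    unfolding eventually_at_right_field by (intro exI[of _ 1]) auto
qed simp

lemma sym_form:
  assumes "sym_pos_def M"
  shows "v \<bullet> (M *v z) = z \<bullet> (M *v v)"
proof -
  have "v \<bullet> (M *v z) = (transpose M *v v) \<bullet> z"
    by (simp add: dot_lmul_matrix transpose_matrix_vector)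
  with assms show ?thesis by (simp add: sym_pos_def_def inner_commute)
qed

lemma qform_nonneg: "sym_pos_def M \<Longrightarrow> 0 \<le> qform M v"
  by (cases "v = 0") (auto simp: sym_pos_def_def less_imp_le)

lemma mnorm_squared: "sym_pos_def M \<Longrightarrow> (mnorm M v)\<^sup>2 = qform M v"
  by (simp add: mnorm_def qform_nonneg)

lemma qform_add:
  assumes "sym_pos_def M"
  shows "qform M (v + s *\<^sub>R z) = qform M v + s * (2 * (z \<bullet> (M *v v))) + s\<^sup>2 * qform M z"
  using sym_form[OF assms, of v z]
  by (simp add: matrix_vector_right_distrib matrix_vector_mult_scaleR inner_add_left inner_add_right
      power2_eq_square algebra_simps)

lemma qform_scale: "qform M (s *\<^sub>R v) = s\<^sup>2 * qform M v"
  by (simp add: matrix_vector_mult_scaleR power2_eq_square)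

text \<open>The \<open>LEAST\<close> in \<open>lambda_min\<close> says nothing until a least
  eigenvalue is known to exist. The form attains its minimum over the compact unit sphere; the
  minimiser is an eigenvector, and by homogeneity the minimum lies below every eigenvalue.\<close>

lemma lambda_min_bound:
  assumes M: "sym_pos_def (M :: real^'n^'n)"
  shows "0 < lambda_min M" and "lambda_min M * (norm v)\<^sup>2 \<le> qform M v"
proof -
  let ?S = "sphere (0 :: real^'n) 1"
  have "continuous_on ?S (qform M)"
    by (intro continuous_intros linear_continuous_on matrix_vector_mul_bounded_linear)
  moreover have "axis (undefined :: 'n) 1 \<in> ?S" by simp
  then have "?S \<noteq> {}" by blast
  ultimately obtain v0 where v0: "v0 \<in> ?S" and min: "\<And>z. z \<in> ?S \<Longrightarrow> qform M v0 \<le> qform M z"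
    using continuous_attains_inf[of ?S "qform M"] by auto
  define l where "l = qform M v0"
  have rayleigh: "l * (norm z)\<^sup>2 \<le> qform M z" for z
  proof (cases "z = 0")
    case False
    then have "l \<le> qform M ((1 / norm z) *\<^sub>R z)"
      unfolding l_def by (intro min) simp
    then have "l \<le> (1 / norm z)\<^sup>2 * qform M z" by (simp only: qform_scale)
    with False show ?thesis by (simp add: field_simps)
  qed simp
  have nz: "v0 \<noteq> 0" using v0 by auto
  have "M *v v0 = l *\<^sub>R v0"
  proof -
    define r where "r = M *v v0 - l *\<^sub>R v0"
    \<comment> \<open>\<open>v0\<close> is perturbed in the direction opposite to the residual
      \<open>r\<close> of the eigenvalue equation. The first-order change of form minus
      \<open>l\<close> times squared norm is a negative multiple of \<open>r \<bullet> r\<close>, so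
      minimality forces \<open>r = 0\<close>.\<close>
    have "0 \<le> - (r \<bullet> r)"
    proof (rule linear_term_nonneg[where c = "(qform M r - l * (r \<bullet> r)) / 2"])
      fix s :: real
      have "l * (norm (v0 + (-s) *\<^sub>R r))\<^sup>2 \<le> qform M (v0 + (-s) *\<^sub>R r)" by (rule rayleigh)
      moreover have "(norm (v0 + (-s) *\<^sub>R r))\<^sup>2 = 1 - 2 * s * (r \<bullet> v0) + s\<^sup>2 * (r \<bullet> r)"
        using v0 unfolding power2_norm_eq_inner
        by (simp add: inner_add_left inner_add_right inner_diff_left inner_diff_right inner_commute power2_eq_square
            norm_eq_1 algebra_simps)
      ultimately have "l * (1 - 2 * s * (r \<bullet> v0) + s\<^sup>2 * (r \<bullet> r)) \<le>
          l + (-s) * (2 * (r \<bullet> (M *v v0))) + (-s)\<^sup>2 * qform M r"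
        unfolding qform_add[OF M] l_def by simp
      moreover have "r \<bullet> (M *v v0) = r \<bullet> r + l * (r \<bullet> v0)"
        using inner_diff_right[of r "M *v v0" "l *\<^sub>R v0"] by (simp flip: r_def)
      ultimately show "0 \<le> s * - (r \<bullet> r) + s\<^sup>2 * ((qform M r - l * (r \<bullet> r)) / 2)"
        by (simp add: algebra_simps)
    qed
    then have "r = 0" by (metis inner_eq_zero_iff inner_ge_zero neg_0_le_iff_le order_antisym)
    then show ?thesis by (simp add: r_def)
  qed
  then have "eigval M l" using nz unfolding eigval_def by blast
  moreover have "l \<le> l'" if ev: "eigval M l'" for l'
  proof -
    obtain z where z: "z \<noteq> 0" "M *v z = l' *\<^sub>R z"
      using ev unfolding eigval_def by blast
    then show ?thesis using rayleigh[of z] by (simp add: power2_norm_eq_inner)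
  qed
  ultimately have eq: "lambda_min M = l"
    unfolding lambda_min_def by (rule Least_equality)
  show "0 < lambda_min M" using M nz unfolding eq l_def sym_pos_def_def by blast
  show "lambda_min M * (norm v)\<^sup>2 \<le> qform M v" using rayleigh eq by simp
qed

section \<open>Optimality conditions of the two subproblems\<close>

text \<open>On the segment from \<open>z0\<close> to \<open>z\<close>, convexity bounds
  \<open>h\<close> by linear interpolation while \<open>l\<close> expands exactly to second order;
  the first-order term of the comparison is the claim. \<open>D\<close> thus acts as the directional
  derivative of \<open>l\<close> at \<open>z0\<close>. Comparison with a point of the domain gives
  finiteness.\<close>

lemma minimizer_variational_inequality:
  fixes h :: "'a::euclidean_space \<Rightarrow> ereal"
  assumes h: "proper_closed_convex h"
    and min: "\<And>z. h z0 + ereal (l z0) \<le> h z + ereal (l z)"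
    and expand: "\<And>s d. l (z0 + s *\<^sub>R d) = l z0 + s * D d + s\<^sup>2 * E d"
  shows "\<bar>h z0\<bar> \<noteq> \<infinity>" and "h z0 \<le> h z + ereal (D (z - z0))"
proof -
  have pr: "h z \<noteq> -\<infinity>" for z
    using h unfolding proper_closed_convex_def proper_def by blast
  obtain z1 where "h z1 < \<infinity>"
    using h unfolding proper_closed_convex_def proper_def dom_def by blast
  with min[of z1] show fin: "\<bar>h z0\<bar> \<noteq> \<infinity>"
    using pr[of z0] by (cases "h z0"; cases "h z1") auto
  then obtain a where a: "h z0 = ereal a" by (cases "h z0") auto
  show "h z0 \<le> h z + ereal (D (z - z0))"
  proof (cases "h z")
    case (real c)
    have "0 \<le> c - a + D (z - z0)"
    proof (rule linear_term_nonneg)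
      fix s :: real
      assume s: "0 < s" "s \<le> 1"
      have "convex (epi h)" "(z0, a) \<in> epi h" "(z, c) \<in> epi h"
        using h a real by (auto simp: proper_closed_convex_def epi_def)
      then have "(1 - s) *\<^sub>R (z0, a) + s *\<^sub>R (z, c) \<in> epi h"
        using s by (intro convexD) auto
      then have "h (z0 + s *\<^sub>R (z - z0)) \<le> ereal ((1 - s) * a + s * c)"
        by (simp add: epi_def algebra_simps)
      then have "h (z0 + s *\<^sub>R (z - z0)) + ereal (l (z0 + s *\<^sub>R (z - z0))) \<le>
          ereal ((1 - s) * a + s * c) + ereal (l (z0 + s *\<^sub>R (z - z0)))"
        by (rule add_right_mono)
      from order_trans[OF min this]
      show "0 \<le> s * (c - a + D (z - z0)) + s\<^sup>2 * E (z - z0)"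
        unfolding expand a by (simp add: algebra_simps)
    qed
    then show ?thesis by (simp add: a real)
  qed (use pr a in auto)
qed

lemma is_arg_min_le:
  fixes F :: "'a \<Rightarrow> 'b::linorder"
  shows "is_arg_min F (\<lambda>_. True) x \<Longrightarrow> F x \<le> F z"
  by (auto simp: is_arg_min_def not_less)

lemma x_step:
  fixes A :: "real^'q^'m" and B :: "real^'p^'m"
  assumes g: "proper_closed_convex g" and S: "sym_pos_def S" and t: "0 < t"
    and min: "is_arg_min (x_objective g A B b S t u w y) (\<lambda>_. True) x"
  shows "\<bar>g x\<bar> \<noteq> \<infinity>"
    and "g x \<le> g z + ereal (y \<bullet> (A *v (z - x)) + (1 / t) * ((z - x) \<bullet> (S *v (x - u))))"
proof -
  define l where "l z = y \<bullet> (A *v z + B *v w - b) + 1 / (2 * t) * qform S (z - u)" for z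
  have obj: "x_objective g A B b S t u w y z = g z + ereal (l z)" for z
    by (simp add: x_objective_def lagrangian_def Phi_def mnorm_squared[OF S] l_def add.assoc)
  have expand: "l (x + s *\<^sub>R d) = l x + s * (y \<bullet> (A *v d) + (1 / t) * (d \<bullet> (S *v (x - u))))
      + s\<^sup>2 * (qform S d / (2 * t))" for s d
  proof -
    have eq: "x + s *\<^sub>R d - u = (x - u) + s *\<^sub>R d" by simp
    show ?thesis
      unfolding l_def eq qform_add[OF S]
      using t by (simp add: matrix_vector_right_distrib matrix_vector_mult_scaleR inner_add_right inner_diff_right
          field_simps)
  qed
  have m: "g x + ereal (l x) \<le> g z + ereal (l z)" for z
    using is_arg_min_le[OF min, of z] unfolding obj .
  show "\<bar>g x\<bar> \<noteq> \<infinity>" 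
    by (rule minimizer_variational_inequality(1)[OF g m expand])
  show "g x \<le> g z + ereal (y \<bullet> (A *v (z - x)) + (1 / t) * ((z - x) \<bullet> (S *v (x - u))))"
    by (rule minimizer_variational_inequality(2)[OF g m expand])
qed

text \<open>The gradient of the penalty merges with \<open>y\<close> into
  \<open>y + \<sigma> *\<^sub>R (A *v x + B *v w - b)\<close>, which is the updated multiplier of
  the algorithm. Finiteness of \<open>g x\<close> turns the objective into \<open>f\<close> plus a
  real-valued quadratic.\<close>

lemma w_step:
  fixes A :: "real^'q^'m" and B :: "real^'p^'m"
  assumes f: "proper_closed_convex f" and T: "sym_pos_def T" and gx: "\<bar>g x\<bar> \<noteq> \<infinity>"
    and min: "is_arg_min (w_objective g f A B b T \<sigma> w' x y) (\<lambda>_. True) w"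
  shows "\<bar>f w\<bar> \<noteq> \<infinity>"
    and "f w \<le> f z + ereal ((y + \<sigma> *\<^sub>R (A *v x + B *v w - b)) \<bullet> (B *v (z - w))
            + (z - w) \<bullet> (T *v (w - w')))"
proof -
  obtain c where c: "g x = ereal c" using gx by (cases "g x") auto
  define l where "l z = c + y \<bullet> (A *v x + B *v z - b) + \<sigma> / 2 * (norm (A *v x + B *v z - b))\<^sup>2
      + qform T (z - w') / 2" for z
  have obj: "w_objective g f A B b T \<sigma> w' x y z = f z + ereal (l z)" for z
    by (cases "f z") (simp_all add: w_objective_def aug_lagrangian_def lagrangian_def Phi_def mnorm_squared[OF T] c l_def)
  have expand: "l (w + s *\<^sub>R d) = l w + s * ((y + \<sigma> *\<^sub>R (A *v x + B *v w - b)) \<bullet> (B *v d) + d \<bullet> (T *v (w - w')))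
      + s\<^sup>2 * (\<sigma> / 2 * (norm (B *v d))\<^sup>2 + qform T d / 2)" for s d
  proof -
    define R where "R = A *v x + B *v w - b"
    have eq: "w + s *\<^sub>R d - w' = (w - w') + s *\<^sub>R d"
      "A *v x + B *v (w + s *\<^sub>R d) - b = R + s *\<^sub>R (B *v d)"
      by (simp_all add: R_def matrix_vector_right_distrib matrix_vector_mult_scaleR)
    show ?thesis
      unfolding l_def eq qform_add[OF T] R_def[symmetric] power2_norm_eq_inner
      by (simp add: inner_add_right inner_add_left inner_commute power2_eq_square field_simps)
  qed
  have m: "f w + ereal (l w) \<le> f z + ereal (l z)" for z
    using is_arg_min_le[OF min, of z] unfolding obj .
  show "\<bar>f w\<bar> \<noteq> \<infinity>" 
    by (rule minimizer_variational_inequality(1)[OF f m expand])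
  show "f w \<le> f z + ereal ((y + \<sigma> *\<^sub>R (A *v x + B *v w - b)) \<bullet> (B *v (z - w))
            + (z - w) \<bullet> (T *v (w - w')))"
    by (rule minimizer_variational_inequality(2)[OF f m expand])
qed

section \<open>Saddle points and limits of inequalities\<close>

lemma saddle_pointD:
  fixes g :: "real^'q \<Rightarrow> ereal" and f :: "real^'p \<Rightarrow> ereal"
  assumes g: "proper_closed_convex g" and f: "proper_closed_convex f"
    and sp: "saddle_point g f A B b xs ws ys"
  shows "\<bar>g xs\<bar> \<noteq> \<infinity>" and "\<bar>f ws\<bar> \<noteq> \<infinity>" and "A *v xs + B *v ws = b"
    and "g xs + f ws \<le> g x + f w + ereal (ys \<bullet> (A *v x + B *v w - b))"
proof -
  have ng: "g z \<noteq> -\<infinity>" and nf: "f z' \<noteq> -\<infinity>" for z z'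
    using g f unfolding proper_closed_convex_def proper_def by blast+
  obtain x1 w1 where dom: "g x1 < \<infinity>" "f w1 < \<infinity>"
    using g f unfolding proper_closed_convex_def proper_def dom_def by blast
  have le: "lagrangian g f A B b xs ws ys \<le> lagrangian g f A B b x w ys" for x w
    using sp by (auto simp: saddle_point_def)
  have up: "lagrangian g f A B b xs ws y \<le> lagrangian g f A B b xs ws ys" for y
    using sp by (auto simp: saddle_point_def)
  have "lagrangian g f A B b x1 w1 ys < \<infinity>"
    using dom by (cases "g x1"; cases "f w1") (auto simp: lagrangian_def Phi_def)
  with le[of x1 w1] have "lagrangian g f A B b xs ws ys < \<infinity>" by (rule order_le_less_trans)
  then show gs: "\<bar>g xs\<bar> \<noteq> \<infinity>" and fs: "\<bar>f ws\<bar> \<noteq> \<infinity>"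
    using ng[of xs] nf[of ws] by (cases "g xs"; cases "f ws"; auto simp: lagrangian_def Phi_def)+
  define R where "R = A *v xs + B *v ws - b"
  \<comment> \<open>Shifting the multiplier by the residual itself raises the Lagrangian by
    \<open>R \<bullet> R\<close>, which maximality in the multiplier forbids unless
    \<open>R = 0\<close>.\<close>
  have "R \<bullet> R \<le> 0"
    using up[of "ys + R"] gs fs
    by (cases "g xs"; cases "f ws")
      (auto simp: lagrangian_def Phi_def R_def[symmetric] inner_add_left)
  then have "R = 0" by (metis inner_eq_zero_iff inner_ge_zero order_antisym)
  then show feas: "A *v xs + B *v ws = b" by (simp add: R_def)
  show "g xs + f ws \<le> g x + f w + ereal (ys \<bullet> (A *v x + B *v w - b))"
    using le[of x w] by (simp add: lagrangian_def Phi_def feas)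
qed

text \<open>This is the form in which limits of the optimality conditions arrive: the two separate
  inequalities add up to minimality, and feasibility makes the Lagrangian constant in the
  multiplier.\<close>

lemma saddle_pointI:
  fixes g :: "real^'q \<Rightarrow> ereal" and f :: "real^'p \<Rightarrow> ereal"
  assumes feas: "A *v xs + B *v ws = b"
    and g: "\<And>x. g xs \<le> g x + ereal (ys \<bullet> (A *v (x - xs)))"
    and f: "\<And>w. f ws \<le> f w + ereal (ys \<bullet> (B *v (w - ws)))"
  shows "saddle_point g f A B b xs ws ys"
  unfolding saddle_point_def
proof (intro allI conjI)
  fix x w y
  show "lagrangian g f A B b xs ws y \<le> lagrangian g f A B b xs ws ys"
    by (simp add: lagrangian_def feas)
  have "g xs + f ws \<le> (g x + ereal (ys \<bullet> (A *v (x - xs)))) + (f w + ereal (ys \<bullet> (B *v (w - ws))))"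
    by (intro add_mono g f)
  also have "\<dots> = (g x + f w) + ereal (ys \<bullet> (A *v (x - xs)) + ys \<bullet> (B *v (w - ws)))"
    by (simp add: ac_simps flip: plus_ereal.simps(1))
  also have "ys \<bullet> (A *v (x - xs)) + ys \<bullet> (B *v (w - ws)) = ys \<bullet> (A *v x + B *v w - b)"
    by (simp add: matrix_vector_mult_diff_distrib inner_add_right inner_diff_right flip: feas)
  finally show "lagrangian g f A B b xs ws ys \<le> lagrangian g f A B b x w ys"
    by (simp add: lagrangian_def Phi_def feas)
qed

text \<open>Lower semicontinuity read off the closed epigraph, which contains the converging points
  \<open>(z n, r + e n)\<close>. The constant \<open>c\<close> is extended real because it will be
  the value of \<open>g\<close> or \<open>f\<close> at an arbitrary point.\<close>

lemma epi_closed_limit: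
  fixes h :: "'a::euclidean_space \<Rightarrow> ereal"
  assumes h: "proper_closed_convex h" and z: "z \<longlonglongrightarrow> zs" and e: "e \<longlonglongrightarrow> es"
    and le: "\<And>n. h (z n) \<le> c + ereal (e n)"
  shows "h zs \<le> c + ereal es"
proof (cases c)
  case (real r)
  have "(\<lambda>n. (z n, r + e n)) \<longlonglongrightarrow> (zs, r + es)"
    by (intro tendsto_intros z e)
  moreover have "closed (epi h)" using h by (simp add: proper_closed_convex_def)
  moreover have "(z n, r + e n) \<in> epi h" for n
    using le[of n] by (simp add: epi_def real)
  ultimately have "(zs, r + es) \<in> epi h"
    using closed_sequentially[of "epi h" "\<lambda>n. (z n, r + e n)"] by simp
  then show ?thesis by (simp add: epi_def real)
next
  case MInf
  then have "h (z 0) = -\<infinity>" using le[of 0] by simp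
  then show ?thesis using h unfolding proper_closed_convex_def proper_def by blast
qed simp

section \<open>Identities and estimates for one step\<close>

lemma qform_minus_commute: "qform M (v - z) = qform M (z - v)"
  by (simp add: matrix_vector_mult_diff_distrib inner_diff_left inner_diff_right)

text \<open>The law of cosines in the \<open>M\<close>-norm, from expanding
  \<open>v - a = (p - a) - (p - v)\<close>. It converts the inner products of the optimality
  conditions into differences of squares.\<close>

lemma three_point:
  assumes "sym_pos_def M"
  shows "2 * ((a - p) \<bullet> (M *v (p - v))) = qform M (v - a) - qform M (p - a) - qform M (p - v)"
proof -
  have "v - a = (p - a) + (-1) *\<^sub>R (p - v)" by simp
  then have "qform M (v - a) = qform M (p - a) + (-1) * (2 * ((p - v) \<bullet> (M *v (p - a)))) + (-1)\<^sup>2 * qform M (p - v)"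
    by (simp only: qform_add[OF assms])
  also have "(p - v) \<bullet> (M *v (p - a)) = - ((a - p) \<bullet> (M *v (p - v)))"
    by (subst sym_form[OF assms]) (simp add: inner_diff_left)
  finally show ?thesis by simp
qed

text \<open>Trades the new iterate \<open>p\<close> for the averaged points, so that the descent estimate telescopes
  in the \<open>u\<^sub>k\<close> instead of the \<open>x\<^sub>k\<close>.\<close>

lemma golden_average:
  assumes "sym_pos_def M" and "1 < \<psi>" and v': "v' = ((\<psi> - 1) / \<psi>) *\<^sub>R p + (1 / \<psi>) *\<^sub>R v"
  shows "qform M (p - a) = \<psi> / (\<psi> - 1) * qform M (v' - a) - 1 / (\<psi> - 1) * qform M (v - a)
    + 1 / \<psi> * qform M (p - v)"
proof -
  define e where "e = p - v"
  have "1 - (\<psi> - 1) / \<psi> = 1 / \<psi>" using assms(2) by (simp add: field_simps)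
  then have "v' = (1 - (\<psi> - 1) / \<psi>) *\<^sub>R v + ((\<psi> - 1) / \<psi>) *\<^sub>R p"
    unfolding v' by simp
  then have 1: "v' - a = (v - a) + ((\<psi> - 1) / \<psi>) *\<^sub>R e"
    by (simp add: e_def scaleR_left_diff_distrib scaleR_right_diff_distrib)
  have 2: "p - a = (v - a) + 1 *\<^sub>R e" by (simp add: e_def)
  \<comment> \<open>Both points are \<open>v - a\<close> plus a multiple of \<open>e\<close>, so
    after expansion only a rational identity in \<open>\<psi>\<close> with coefficients
    \<open>P\<close>, \<open>Q\<close>, \<open>G\<close> remains.\<close>
  define P Q G where "P = e \<bullet> (M *v (v - a))" and "Q = qform M e" and "G = qform M (v - a)"
  have "G + 1 * (2 * P) + 1\<^sup>2 * Q = \<psi> / (\<psi> - 1) * (G + (\<psi> - 1) / \<psi> * (2 * P) + ((\<psi> - 1) / \<psi>)\<^sup>2 * Q)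
      - 1 / (\<psi> - 1) * G + 1 / \<psi> * Q"
    using assms(2) by (simp add: divide_simps power2_eq_square) (simp add: algebra_simps)
  then show ?thesis
    unfolding 1 2 qform_add[OF assms(1)] P_def Q_def G_def e_def[symmetric] .
qed

text \<open>Yields \<open>\<mu> < \<psi> / 2 < 1\<close>, which makes the limiting coefficient of
  the multiplier increments positive.\<close>

lemma golden_lt_2: "golden < 2"
  using real_sqrt_less_mono[of 5 9] by (simp add: golden_def)

text \<open>\<open>golden\<close> is the positive root of
  \<open>\<psi> * \<psi> = \<psi> + 1\<close>; completing the square turns the bound on
  \<open>\<psi>\<close> into \<open>\<psi> * \<psi> \<le> \<psi> + 1\<close>.\<close>

lemma golden_ineq:
  assumes "1 < \<psi>" and "\<psi> \<le> golden"
  shows "\<psi> \<le> 1 + 1 / \<psi>"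
proof -
  have "(2 * \<psi> - 1)\<^sup>2 \<le> (sqrt 5)\<^sup>2"
    using assms by (intro power_mono) (auto simp: golden_def)
  then have "\<psi> * \<psi> \<le> \<psi> + 1" by (simp add: power2_eq_square algebra_simps)
  then show ?thesis using assms(1) by (simp add: field_simps)
qed

text \<open>Cauchy-Schwarz, then the step size bound in place of \<open>norm p\<close>, then Young's
  inequality for \<open>norm e / sqrt \<beta>\<close> and \<open>s\<close>. The cross term carries
  \<open>t1\<close> while the bound is stated for the next step size \<open>t2\<close>; hence the
  ratio.\<close>

lemma young_step:
  fixes e p :: "'a::real_inner"
  assumes t: "0 < t1" "0 < t2" and \<beta>: "0 < \<beta>" and \<mu>: "0 < \<mu>" and s: "0 \<le> s"
    and le: "t2 * norm p \<le> \<mu> / sqrt \<beta> * s"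
  shows "- 2 * t1 * (e \<bullet> p) \<le> t1 / t2 * \<mu> * ((norm e)\<^sup>2 / \<beta> + s\<^sup>2)"
proof -
  have "- 2 * t1 * (e \<bullet> p) \<le> 2 * t1 * (norm e * norm p)"
    using mult_left_mono[of "- (e \<bullet> p)" "norm e * norm p" "2 * t1"] Cauchy_Schwarz_ineq2[of e p] t
    by (simp add: abs_le_iff)
  also have "\<dots> = 2 * (t1 / t2) * norm e * (t2 * norm p)"
    using t by (simp add: field_simps)
  also have "\<dots> \<le> 2 * (t1 / t2) * norm e * (\<mu> / sqrt \<beta> * s)"
    using t le by (intro mult_left_mono) auto
  also have "\<dots> = t1 / t2 * \<mu> * (2 * (norm e / sqrt \<beta>) * s)"
    by simp
  also have "\<dots> \<le> t1 / t2 * \<mu> * ((norm e / sqrt \<beta>)\<^sup>2 + s\<^sup>2)"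
    using t \<mu> sum_squares_bound[of "norm e / sqrt \<beta>" s] by (intro mult_left_mono) auto
  finally show ?thesis using \<beta> by (simp add: power_divide)
qed

text \<open>
  The subscripts 0, 1, 2 are three consecutive steps and \<open>(a, c, d)\<close> is a saddle point. The inequality
  \<open>gg\<close> compares two consecutive iterates; rescaling it by \<open>t1 / t0\<close> and using
  \<open>x1 - u1 = \<psi> (x1 - u2)\<close> yields the negative multiple of \<open>qform S (x2 - x1)\<close> that absorbs the
  coupling term \<open>(y1 - y0) \<bullet> A (x2 - x1)\<close>, at the cost of a positive multiple of
  \<open>qform S (x2 - u2)\<close> which \<open>golden_ineq\<close> compensates.
\<close>

lemma one_step_descent:
  fixes A :: "real^'q^'m" and B :: "real^'p^'m" and a x1 x2 u1 u2 u3 :: "real^'q"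
    and c w0 w1 :: "real^'p" and d y0 y1 b :: "real^'m"
  assumes S: "sym_pos_def S" and T: "sym_pos_def T"
    and t: "0 < t0" "0 < t1" "0 < t2" "t1 \<le> t0"
    and \<beta>: "0 < \<beta>" and \<psi>: "1 < \<psi>" "\<psi> \<le> golden" and \<mu>: "0 < \<mu>"
    and gx: "G2 \<le> Ga + (y1 \<bullet> (A *v (a - x2)) + (1 / t1) * ((a - x2) \<bullet> (S *v (x2 - u2))))"
    and gg: "G1 \<le> G2 + (y0 \<bullet> (A *v (x2 - x1)) + (1 / t0) * ((x2 - x1) \<bullet> (S *v (x1 - u1))))"
    and fw: "F1 \<le> Fc + (y1 \<bullet> (B *v (c - w1)) + (c - w1) \<bullet> (T *v (w1 - w0)))"
    and saddle: "Ga + Fc \<le> G1 + F1 + d \<bullet> (A *v x1 + B *v w1 - b)"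
    and feas: "A *v a + B *v c = b"
    and y1: "y1 = y0 + (\<beta> * t1) *\<^sub>R (A *v x1 + B *v w1 - b)"
    and u2: "u2 = ((\<psi> - 1) / \<psi>) *\<^sub>R x1 + (1 / \<psi>) *\<^sub>R u1"
    and u3: "u3 = ((\<psi> - 1) / \<psi>) *\<^sub>R x2 + (1 / \<psi>) *\<^sub>R u2"
    and A: "t2 * norm (A *v (x2 - x1)) \<le> \<mu> / sqrt \<beta> * sqrt (qform S (x2 - x1))"
  shows "\<psi> / (\<psi> - 1) * qform S (u3 - a) + t1 * qform T (w1 - c) + (norm (y1 - d))\<^sup>2 / \<beta>
      + ((\<psi> * (t1 / t0) - t1 / t2 * \<mu>) * qform S (x2 - x1) + \<psi> * (t1 / t0) * qform S (x1 - u2)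
         + t1 * qform T (w1 - w0) + (1 - t1 / t2 * \<mu>) / \<beta> * (norm (y1 - y0))\<^sup>2)
    \<le> \<psi> / (\<psi> - 1) * qform S (u2 - a) + t0 * qform T (w0 - c) + (norm (y0 - d))\<^sup>2 / \<beta>"
proof -
  define R where "R = A *v x1 + B *v w1 - b"
  \<comment> \<open>Writing \<open>b\<close> as \<open>A *v a + B *v c\<close> leaves two couplings:
    one with the residual, which becomes a difference of squares in the multiplier, and a cross term
    left to \<open>young_step\<close>.\<close>
  have bil: "y1 \<bullet> (A *v (a - x2)) + y0 \<bullet> (A *v (x2 - x1)) + y1 \<bullet> (B *v (c - w1)) + d \<bullet> R
      = (d - y1) \<bullet> R - (y1 - y0) \<bullet> (A *v (x2 - x1))"
    unfolding R_def feas[symmetric]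
    by (simp add: matrix_vector_mult_diff_distrib inner_simps algebra_simps)
  have "0 \<le> (d - y1) \<bullet> R - (y1 - y0) \<bullet> (A *v (x2 - x1)) + (1 / t1) * ((a - x2) \<bullet> (S *v (x2 - u2)))
      + (1 / t0) * ((x2 - x1) \<bullet> (S *v (x1 - u1))) + (c - w1) \<bullet> (T *v (w1 - w0))"
    using gx gg fw saddle bil by (simp add: R_def)
  \<comment> \<open>The factor \<open>2 * t1\<close> frees the term in \<open>x2 - u2\<close> from
    its step size, so that its squares telescope; the \<open>T\<close>-term keeps the weight
    \<open>t1\<close>.\<close>
  then have "0 \<le> 2 * t1 * ((d - y1) \<bullet> R - (y1 - y0) \<bullet> (A *v (x2 - x1)) + (1 / t1) * ((a - x2) \<bullet> (S *v (x2 - u2)))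
      + (1 / t0) * ((x2 - x1) \<bullet> (S *v (x1 - u1))) + (c - w1) \<bullet> (T *v (w1 - w0)))"
    using t by simp
  also have "\<dots> = 2 * t1 * ((d - y1) \<bullet> R) - 2 * t1 * ((y1 - y0) \<bullet> (A *v (x2 - x1)))
      + 2 * ((a - x2) \<bullet> (S *v (x2 - u2)))
      + t1 / t0 * (2 * ((x2 - x1) \<bullet> (S *v (x1 - u1)))) + t1 * (2 * ((c - w1) \<bullet> (T *v (w1 - w0))))"
    using t by (simp add: field_simps)
  finally have main: "0 \<le> \<dots>" .
  have yy: "2 * t1 * ((d - y1) \<bullet> R) = (norm (y0 - d))\<^sup>2 / \<beta> - (norm (y1 - d))\<^sup>2 / \<beta> - (norm (y1 - y0))\<^sup>2 / \<beta>"
  proof -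
    have R: "y1 - y0 = (\<beta> * t1) *\<^sub>R R" unfolding y1 R_def by simp
    have "2 * t1 * ((d - y1) \<bullet> R) = 2 * ((d - y1) \<bullet> (y1 - y0)) / \<beta>"
      unfolding R using \<beta> by simp
    also have "2 * ((d - y1) \<bullet> (y1 - y0)) = (norm (y0 - d))\<^sup>2 - (norm (y1 - d))\<^sup>2 - (norm (y1 - y0))\<^sup>2"
      unfolding power2_norm_eq_inner by (simp add: inner_diff_left inner_diff_right inner_commute)
    finally show ?thesis by (simp add: diff_divide_distrib)
  qed
  have young: "- 2 * t1 * ((y1 - y0) \<bullet> (A *v (x2 - x1)))
      \<le> t1 / t2 * \<mu> * ((norm (y1 - y0))\<^sup>2 / \<beta> + qform S (x2 - x1))"
    using young_step[OF t(2,3) \<beta> \<mu> _ A, of "y1 - y0"] qform_nonneg[OF S] by simp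
  have xu1: "x1 - u1 = \<psi> *\<^sub>R (x1 - u2)"
  proof -
    have "\<psi> *\<^sub>R u2 = (\<psi> - 1) *\<^sub>R x1 + u1"
      unfolding u2 using \<psi> by (simp add: scaleR_right_distrib)
    then show ?thesis by (simp add: scaleR_right_diff_distrib scaleR_left_diff_distrib)
  qed
  have s2: "2 * ((x2 - x1) \<bullet> (S *v (x1 - u1)))
      = \<psi> * (qform S (x2 - u2) - qform S (x2 - x1) - qform S (x1 - u2))"
    unfolding xu1 matrix_vector_mult_scaleR inner_scaleR_right
    using three_point[OF S, of x2 x1 u2] qform_minus_commute[of x2 u2 S] qform_minus_commute[of x2 x1 S]
    by simp
  have s1: "2 * ((a - x2) \<bullet> (S *v (x2 - u2)))
      = \<psi> / (\<psi> - 1) * qform S (u2 - a) - \<psi> / (\<psi> - 1) * qform S (u3 - a) - (1 + 1 / \<psi>) * qform S (x2 - u2)"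
  proof -
    have "\<psi> / (\<psi> - 1) = 1 + 1 / (\<psi> - 1)" using \<psi> by (simp add: field_simps)
    then show ?thesis
      unfolding three_point[OF S] golden_average[OF S \<psi>(1) u3, of a] by (simp add: algebra_simps)
  qed
  have tt: "2 * ((c - w1) \<bullet> (T *v (w1 - w0))) = qform T (w0 - c) - qform T (w1 - c) - qform T (w1 - w0)"
    by (rule three_point[OF T])
  have "t1 / t0 * \<psi> \<le> 1 * \<psi>" using t \<psi> by (intro mult_right_mono) auto
  then have "t1 / t0 * \<psi> \<le> 1 + 1 / \<psi>" using golden_ineq[OF \<psi>] by simp
  then have coef: "t1 / t0 * \<psi> * qform S (x2 - u2) \<le> (1 + 1 / \<psi>) * qform S (x2 - u2)"
    using qform_nonneg[OF S] by (intro mult_right_mono) auto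
  \<comment> \<open>Raising the weight at \<open>w0\<close> to \<open>t0\<close> gives both sides of
    the estimate the step size of their own index.\<close>
  have tw: "t1 * qform T (w0 - c) \<le> t0 * qform T (w0 - c)"
    using t qform_nonneg[OF T] by (intro mult_right_mono) auto
  define r del where "r = t1 / t2 * \<mu>" and "del = t1 / t0"
  show ?thesis
    using main young coef tw unfolding yy s1 s2 tt r_def[symmetric] del_def[symmetric]
    by (simp add: algebra_simps diff_divide_distrib)
qed

section \<open>From a Lyapunov decrease to limits and bounds\<close>

text \<open>From some index on \<open>V\<close> decreases and is bounded below, so it converges, and
  \<open>E n\<close> is squeezed between 0 and \<open>V n - V (Suc n)\<close>. The decrease is only
  eventual because early coefficients may have the wrong sign.\<close>

lemma lyapunov:
  fixes V E :: "nat \<Rightarrow> real"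
  assumes dec: "\<forall>\<^sub>F n in sequentially. V (Suc n) + E n \<le> V n"
    and V: "\<And>n. 0 \<le> V n" and E: "\<And>n. 0 \<le> E n"
  shows "convergent V" and "E \<longlonglongrightarrow> 0"
proof -
  obtain N where N: "\<And>n. n \<ge> N \<Longrightarrow> V (Suc n) + E n \<le> V n"
    using dec by (auto simp: eventually_sequentially)
  have "decseq (\<lambda>n. V (n + N))"
    unfolding decseq_Suc_iff using N E by (metis add_Suc add.commute le_add1 le_add_same_cancel1 order_trans)
  then obtain L where "(\<lambda>n. V (n + N)) \<longlonglongrightarrow> L" using V decseq_convergent[of "\<lambda>n. V (n + N)" 0] by blast
  then have L: "V \<longlonglongrightarrow> L" by (rule LIMSEQ_offset)
  then show "convergent V" by (rule convergentI)
  have "(\<lambda>n. V n - V (Suc n)) \<longlonglongrightarrow> L - L" by (intro tendsto_diff L LIMSEQ_Suc)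
  then have "(\<lambda>n. V n - V (Suc n)) \<longlonglongrightarrow> 0" by simp
  moreover have "\<forall>\<^sub>F n in sequentially. E n \<le> V n - V (Suc n)"
    using dec by eventually_elim simp
  ultimately show "E \<longlonglongrightarrow> 0"
    using E by (intro Lim_null_comparison[of E]) auto
qed

lemma null_of_square_bound:
  fixes z :: "nat \<Rightarrow> 'a::real_normed_vector"
  assumes "0 < c" and le: "\<And>n. c * (norm (z n))\<^sup>2 \<le> e n" and e: "e \<longlonglongrightarrow> 0"
  shows "z \<longlonglongrightarrow> 0"
proof -
  have "(\<lambda>n. e n / c) \<longlonglongrightarrow> 0 / c" by (intro tendsto_divide e tendsto_const) (use \<open>0 < c\<close> in simp)
  moreover have "(norm (z n))\<^sup>2 \<le> e n / c" for n using le[of n] \<open>0 < c\<close> by (simp add: field_simps)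
  ultimately have "(\<lambda>n. (norm (z n))\<^sup>2) \<longlonglongrightarrow> 0"
    by (intro Lim_null_comparison[of "\<lambda>n. (norm (z n))\<^sup>2"]) auto
  then have "(\<lambda>n. sqrt ((norm (z n))\<^sup>2)) \<longlonglongrightarrow> sqrt 0" by (rule tendsto_real_sqrt)
  then show ?thesis by (simp add: tendsto_norm_zero_iff)
qed

lemma null_of_qform_bound:
  fixes z :: "nat \<Rightarrow> real^'n"
  assumes M: "sym_pos_def M" and "0 < c" and le: "\<And>n. c * qform M (z n) \<le> e n" and e: "e \<longlonglongrightarrow> 0"
  shows "z \<longlonglongrightarrow> 0"
proof (rule null_of_square_bound[OF _ _ e])
  show "0 < c * lambda_min M" using lambda_min_bound(1)[OF M] \<open>0 < c\<close> by simp
  show "c * lambda_min M * (norm (z n))\<^sup>2 \<le> e n" for n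
    using order_trans[OF mult_left_mono[OF lambda_min_bound(2)[OF M, of "z n"], of c] le[of n]] \<open>0 < c\<close>
    by (simp add: mult.assoc)
qed

lemma bounded_of_square_bound:
  fixes z :: "nat \<Rightarrow> 'a::real_normed_vector"
  assumes "0 < c" and le: "\<And>n. c * (norm (z n - a))\<^sup>2 \<le> K"
  shows "bounded (range z)"
proof (rule boundedI)
  fix v assume "v \<in> range z"
  then obtain n where v: "v = z n" by blast
  have "(norm (z n - a))\<^sup>2 \<le> K / c" using le[of n] \<open>0 < c\<close> by (simp add: field_simps)
  then have "norm (z n - a) \<le> sqrt (K / c)" by (rule real_le_rsqrt)
  then show "norm v \<le> sqrt (K / c) + norm a"
    using norm_triangle_sub[of "z n" a] by (simp add: v)
qed

lemma bounded_of_qform_bound: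
  fixes z :: "nat \<Rightarrow> real^'n"
  assumes M: "sym_pos_def M" and "0 < c" and le: "\<And>n. c * qform M (z n - a) \<le> K"
  shows "bounded (range z)"
proof (rule bounded_of_square_bound)
  show "0 < c * lambda_min M" using lambda_min_bound(1)[OF M] \<open>0 < c\<close> by simp
  show "c * lambda_min M * (norm (z n - a))\<^sup>2 \<le> K" for n
    using order_trans[OF mult_left_mono[OF lambda_min_bound(2)[OF M, of "z n - a"], of c] le[of n]] \<open>0 < c\<close>
    by (simp add: mult.assoc)
qed

lemma tendsto_matrix_vector_mult:
  fixes M :: "real^'n^'m"
  assumes "z \<longlonglongrightarrow> l"
  shows "(\<lambda>n. M *v z n) \<longlonglongrightarrow> M *v l"
  by (rule bounded_linear.tendsto[OF matrix_vector_mul_bounded_linear assms])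

section \<open>Runs of the algorithm and their step sizes\<close>

text \<open>No saddle point is fixed here, since the descent is applied to two of them: the given
  one and later a cluster point.\<close>

locale golden_ratio_admm =
  fixes g :: "real^'q \<Rightarrow> ereal" and f :: "real^'p \<Rightarrow> ereal"
    and A :: "real^'q^'m" and B :: "real^'p^'m" and b :: "real^'m"
    and S :: "real^'q^'q" and T :: "real^'p^'p"
    and \<beta> \<psi> \<mu> :: real
    and u x :: "nat \<Rightarrow> real^'q" and \<tau> :: "nat \<Rightarrow> real"
    and w :: "nat \<Rightarrow> real^'p" and y :: "nat \<Rightarrow> real^'m"
  assumes g: "proper_closed_convex g" and f: "proper_closed_convex f"
    and S: "sym_pos_def S" and T: "sym_pos_def T"
    and tau0: "\<tau> 0 > 0" and \<beta>: "\<beta> > 0"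
    and \<psi>: "1 < \<psi>" "\<psi> \<le> golden"
    and \<mu>: "0 < \<mu>" "\<mu> < \<psi> / 2"
    and run: "algorithm1 g f A B b S T \<beta> \<psi> \<mu> u x \<tau> w y"
begin

lemma u_step: "u (Suc n) = ((\<psi> - 1) / \<psi>) *\<^sub>R x n + (1 / \<psi>) *\<^sub>R u n"
  and x_min: "is_arg_min (x_objective g A B b S (\<tau> n) (u (Suc n)) (w n) (y n)) (\<lambda>_. True) (x (Suc n))"
  and tau_step: "\<tau> (Suc n) = (if A *v x (Suc n) = A *v x n then \<tau> n
      else min (\<tau> n) (\<mu> * sqrt (lambda_min S) / (sqrt \<beta> * local_lipschitz A (x (Suc n)) (x n))))"
  and w_min: "is_arg_min (w_objective g f A B b T (\<beta> * \<tau> (Suc n)) (w n) (x (Suc n)) (y n))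
      (\<lambda>_. True) (w (Suc n))"
  and y_step: "y (Suc n) = y n + (\<beta> * \<tau> (Suc n)) *\<^sub>R (A *v x (Suc n) + B *v w (Suc n) - b)"
proof -
  have *: "1 \<le> Suc n" "Suc n - 1 = n" by simp_all
  note step = run[unfolded algorithm1_def, THEN conjunct2, rule_format, OF *(1), unfolded *(2)]
  from step show "u (Suc n) = ((\<psi> - 1) / \<psi>) *\<^sub>R x n + (1 / \<psi>) *\<^sub>R u n" by blast
  from step show "is_arg_min (x_objective g A B b S (\<tau> n) (u (Suc n)) (w n) (y n)) (\<lambda>_. True) (x (Suc n))" by blast
  from step show "\<tau> (Suc n) = (if A *v x (Suc n) = A *v x n then \<tau> n
      else min (\<tau> n) (\<mu> * sqrt (lambda_min S) / (sqrt \<beta> * local_lipschitz A (x (Suc n)) (x n))))" by blast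
  from step show "is_arg_min (w_objective g f A B b T (\<beta> * \<tau> (Suc n)) (w n) (x (Suc n)) (y n))
      (\<lambda>_. True) (w (Suc n))" by blast
  from step show "y (Suc n) = y n + (\<beta> * \<tau> (Suc n)) *\<^sub>R (A *v x (Suc n) + B *v w (Suc n) - b)" by blast
qed

lemma tau_antimono: "\<tau> (Suc n) \<le> \<tau> n"
  unfolding tau_step by auto

text \<open>Every local Lipschitz quotient is at most an operator bound \<open>K\<close> of
  \<open>A\<close>, so the minimum in the step size rule never falls below the value computed with
  \<open>K\<close>.\<close>

lemma tau_lower_bound: "\<exists>m>0. \<forall>n. m \<le> \<tau> n"
proof -
  obtain K where K: "0 < K" "\<And>v. norm (A *v v) \<le> norm v * K"
    using bounded_linear.pos_bounded[OF matrix_vector_mul_bounded_linear[of A]] by blast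
  define m where "m = min (\<tau> 0) (\<mu> * sqrt (lambda_min S) / (sqrt \<beta> * K))"
  have pos: "0 < \<mu> * sqrt (lambda_min S)"
    using \<mu> lambda_min_bound(1)[OF S] by simp
  then have "0 < m" using tau0 \<beta> K by (simp add: m_def)
  moreover have "m \<le> \<tau> n" for n
  proof (induction n)
    case 0
    show ?case by (simp add: m_def)
  next
    case (Suc n)
    show ?case
    proof (cases "A *v x (Suc n) = A *v x n")
      case False
      then have ne: "x (Suc n) \<noteq> x n" by auto
      define L where "L = local_lipschitz A (x (Suc n)) (x n)"
      have "0 < L" using False ne by (simp add: L_def local_lipschitz_def)
      moreover have "L \<le> K"
        using K(2)[of "x (Suc n) - x n"] ne
        by (simp add: L_def local_lipschitz_def divide_simps matrix_vector_mult_diff_distrib mult.commute)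
      ultimately have "\<mu> * sqrt (lambda_min S) / (sqrt \<beta> * K) \<le> \<mu> * sqrt (lambda_min S) / (sqrt \<beta> * L)"
        using pos \<beta> K(1) by (intro divide_left_mono mult_left_mono mult_pos_pos) auto
      with Suc show ?thesis
        unfolding tau_step L_def[symmetric] using False by (auto simp: m_def)
    qed (use Suc in \<open>simp add: tau_step\<close>)
  qed
  ultimately show ?thesis by blast
qed

lemma tau_pos: "0 < \<tau> n"
  using tau_lower_bound by (meson less_le_trans)

lemma tau_limit: obtains t where "0 < t" and "\<tau> \<longlonglongrightarrow> t"
proof -
  obtain m where m: "0 < m" "\<And>n. m \<le> \<tau> n" using tau_lower_bound by blast
  have "decseq \<tau>" by (simp add: decseq_Suc_iff tau_antimono)
  then obtain t where t: "\<tau> \<longlonglongrightarrow> t" using m decseq_convergent[of \<tau> m] by blast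
  moreover have "m \<le> t" by (rule LIMSEQ_le_const[OF t]) (use m in auto)
  ultimately show ?thesis by (intro that[OF less_le_trans[OF m(1)]])
qed

text \<open>Multiplying the step size rule by \<open>norm (A *v v)\<close> cancels the Lipschitz
  quotient, and \<open>lambda_min S\<close> passes from the Euclidean norm to the
  \<open>S\<close>-norm. This is the hypothesis of \<open>young_step\<close>.\<close>

lemma step_size_bound:
  "\<tau> (Suc n) * norm (A *v (x (Suc n) - x n)) \<le> \<mu> / sqrt \<beta> * sqrt (qform S (x (Suc n) - x n))"
proof (cases "A *v x (Suc n) = A *v x n")
  case True
  then show ?thesis
    using \<mu> \<beta> qform_nonneg[OF S, of "x (Suc n) - x n"] by (simp add: matrix_vector_mult_diff_distrib[of A])
next
  case False
  then have ne: "x (Suc n) \<noteq> x n" by auto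
  define v where "v = x (Suc n) - x n"
  have L: "local_lipschitz A (x (Suc n)) (x n) = norm (A *v v) / norm v" and Av: "0 < norm (A *v v)" and v: "0 < norm v"
    using False ne by (simp_all add: local_lipschitz_def v_def matrix_vector_mult_diff_distrib)
  have "\<tau> (Suc n) \<le> \<mu> * sqrt (lambda_min S) / (sqrt \<beta> * (norm (A *v v) / norm v))"
    unfolding tau_step L[symmetric] using False by simp
  then have "\<tau> (Suc n) * norm (A *v v) \<le> \<mu> / sqrt \<beta> * (sqrt (lambda_min S) * norm v)"
    using Av v \<beta> by (simp add: field_simps)
  also have "sqrt (lambda_min S) * norm v = sqrt (lambda_min S * (norm v)\<^sup>2)"
    by (simp add: real_sqrt_mult)
  also have "\<mu> / sqrt \<beta> * \<dots> \<le> \<mu> / sqrt \<beta> * sqrt (qform S v)"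
    using \<mu> \<beta> lambda_min_bound(2)[OF S] by (intro mult_left_mono real_sqrt_le_mono) auto
  finally show ?thesis by (simp add: v_def)
qed

lemmas g_finite = x_step(1)[OF g S tau_pos x_min]
  and g_ineq = x_step(2)[OF g S tau_pos x_min]

text \<open>Folding \<open>y_step\<close> identifies the multiplier in \<open>w_step\<close> with
  \<open>y (Suc n)\<close>.\<close>

lemmas f_finite = w_step(1)[OF f T g_finite w_min]
  and f_ineq = w_step(2)[OF f T g_finite w_min, folded y_step]

section \<open>The Lyapunov function along the run\<close>

text \<open>The index of \<open>u\<close> runs two ahead because the descent estimate pairs
  \<open>w n\<close> and \<open>y n\<close> with \<open>u (n + 2)\<close>, the proximal centre of
  \<open>x (n + 2)\<close>.\<close>

definition lyap :: "real^'q \<Rightarrow> real^'p \<Rightarrow> real^'m \<Rightarrow> nat \<Rightarrow> real" where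
  "lyap a c d n = \<psi> / (\<psi> - 1) * qform S (u (n + 2) - a) + \<tau> n * qform T (w n - c) + (norm (y n - d))\<^sup>2 / \<beta>"

lemma lyap_descent:
  assumes sp: "saddle_point g f A B b a c d"
  shows "lyap a c d (Suc n) + ((\<psi> * (\<tau> (Suc n) / \<tau> n) - \<tau> (Suc n) / \<tau> (n + 2) * \<mu>) * qform S (x (n + 2) - x (Suc n))
      + \<psi> * (\<tau> (Suc n) / \<tau> n) * qform S (x (Suc n) - u (n + 2))
      + \<tau> (Suc n) * qform T (w (Suc n) - w n)
      + (1 - \<tau> (Suc n) / \<tau> (n + 2) * \<mu>) / \<beta> * (norm (y (Suc n) - y n))\<^sup>2) \<le> lyap a c d n"
proof -
  note sd = saddle_pointD[OF g f sp]
  obtain Ga where Ga: "g a = ereal Ga" using sd(1) by (cases "g a") auto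
  obtain Fc where Fc: "f c = ereal Fc" using sd(2) by (cases "f c") auto
  obtain G1 where G1: "g (x (Suc n)) = ereal G1" using g_finite[of n] by (cases "g (x (Suc n))") auto
  obtain G2 where G2: "g (x (Suc (Suc n))) = ereal G2"
    using g_finite[of "Suc n"] by (cases "g (x (Suc (Suc n)))") auto
  obtain F1 where F1: "f (w (Suc n)) = ereal F1" using f_finite[of n] by (cases "f (w (Suc n))") auto
  have gx: "G2 \<le> Ga + (y (Suc n) \<bullet> (A *v (a - x (Suc (Suc n))))
      + (1 / \<tau> (Suc n)) * ((a - x (Suc (Suc n))) \<bullet> (S *v (x (Suc (Suc n)) - u (Suc (Suc n))))))"
    using g_ineq[of "Suc n" a] by (simp only: Ga G2 plus_ereal.simps ereal_less_eq)
  \<comment> \<open>The condition for \<open>x (Suc n)\<close> is tested at the next iterate rather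
    than at the saddle point, which links two consecutive steps.\<close>
  have gg: "G1 \<le> G2 + (y n \<bullet> (A *v (x (Suc (Suc n)) - x (Suc n)))
      + (1 / \<tau> n) * ((x (Suc (Suc n)) - x (Suc n)) \<bullet> (S *v (x (Suc n) - u (Suc n)))))"
    using g_ineq[of n "x (Suc (Suc n))"] by (simp only: G1 G2 plus_ereal.simps ereal_less_eq)
  have fw: "F1 \<le> Fc + (y (Suc n) \<bullet> (B *v (c - w (Suc n))) + (c - w (Suc n)) \<bullet> (T *v (w (Suc n) - w n)))"
    using f_ineq[of n c] by (simp only: F1 Fc plus_ereal.simps ereal_less_eq)
  have sad: "Ga + Fc \<le> G1 + F1 + d \<bullet> (A *v x (Suc n) + B *v w (Suc n) - b)"
    using sd(4)[of "x (Suc n)" "w (Suc n)"] by (simp only: Ga Fc G1 F1 plus_ereal.simps ereal_less_eq)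
  show ?thesis
    using one_step_descent[OF S T tau_pos tau_pos tau_pos tau_antimono \<beta> \<psi> \<mu>(1) gx gg fw sad sd(3)
        y_step u_step u_step step_size_bound]
    by (simp add: lyap_def)
qed

lemma lyap_nonneg: "0 \<le> lyap a c d n"
  unfolding lyap_def using \<psi> \<beta> tau_pos[of n] qform_nonneg[OF S] qform_nonneg[OF T] by simp

text \<open>The coefficients in \<open>lyap_descent\<close> may be negative at first; they tend to \<open>\<psi> - \<mu>\<close>, \<open>\<psi>\<close>,
  \<open>lim \<tau>\<close> and \<open>(1 - \<mu>) / \<beta>\<close>, because the step sizes have a positive limit.\<close>

lemma lyap_convergence:
  assumes sp: "saddle_point g f A B b a c d"
  shows "convergent (lyap a c d)"
    and "(\<lambda>n. x (n + 2) - x (Suc n)) \<longlonglongrightarrow> 0" and "(\<lambda>n. x (Suc n) - u (n + 2)) \<longlonglongrightarrow> 0"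
    and "(\<lambda>n. w (Suc n) - w n) \<longlonglongrightarrow> 0" and "(\<lambda>n. y (Suc n) - y n) \<longlonglongrightarrow> 0"
proof -
  obtain t where t: "0 < t" "\<tau> \<longlonglongrightarrow> t" by (rule tau_limit)
  obtain m where m: "0 < m" "\<And>n. m \<le> \<tau> n" using tau_lower_bound by blast
  have \<mu>1: "\<mu> < 1" using \<mu> \<psi> golden_lt_2 by simp
  have \<mu>\<psi>: "\<mu> < \<psi>" using \<mu> \<psi> by simp
  have shift: "(\<lambda>n. \<tau> (n + j)) \<longlonglongrightarrow> t" for j using t(2) by (rule LIMSEQ_ignore_initial_segment)
  \<comment> \<open>Half of the limiting coefficient serves as a bound valid from some index on; the
    multiplier coefficient is treated alike.\<close>
  have "(\<lambda>n. \<psi> * (\<tau> (n + 1) / \<tau> (n + 0)) - \<tau> (n + 1) / \<tau> (n + 2) * \<mu>) \<longlonglongrightarrow> \<psi> * (t / t) - t / t * \<mu>"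
    using t(1) by (intro tendsto_intros shift) auto
  moreover have "(\<psi> - \<mu>) / 2 < \<psi> * (t / t) - t / t * \<mu>" using t(1) \<mu>\<psi> by (simp add: field_simps)
  ultimately have ev1: "\<forall>\<^sub>F n in sequentially. (\<psi> - \<mu>) / 2 < \<psi> * (\<tau> (n + 1) / \<tau> (n + 0)) - \<tau> (n + 1) / \<tau> (n + 2) * \<mu>"
    by (rule order_tendstoD(1))
  have "(\<lambda>n. 1 - \<tau> (n + 1) / \<tau> (n + 2) * \<mu>) \<longlonglongrightarrow> 1 - t / t * \<mu>"
    using t(1) by (intro tendsto_intros shift) auto
  moreover have "(1 - \<mu>) / 2 < 1 - t / t * \<mu>" using t(1) \<mu>1 by (simp add: field_simps)
  ultimately have ev2: "\<forall>\<^sub>F n in sequentially. (1 - \<mu>) / 2 < 1 - \<tau> (n + 1) / \<tau> (n + 2) * \<mu>"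
    by (rule order_tendstoD(1))
  define E1 E2 E3 E4 where
    "E1 n = (\<psi> - \<mu>) / 2 * qform S (x (n + 2) - x (Suc n))" and
    "E2 n = (\<psi> - \<mu>) / 2 * qform S (x (Suc n) - u (n + 2))" and
    "E3 n = m * qform T (w (Suc n) - w n)" and
    "E4 n = (1 - \<mu>) / 2 / \<beta> * (norm (y (Suc n) - y n))\<^sup>2" for n
  have nonneg: "0 \<le> E1 n" "0 \<le> E2 n" "0 \<le> E3 n" "0 \<le> E4 n" for n
    unfolding E1_def E2_def E3_def E4_def
    using \<mu>1 \<mu>\<psi> m(1) \<beta> qform_nonneg[OF S] qform_nonneg[OF T] by simp_all
  define E where "E n = E1 n + E2 n + E3 n + E4 n" for n
  have "\<forall>\<^sub>F n in sequentially. lyap a c d (Suc n) + E n \<le> lyap a c d n"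
    using ev1 ev2
  proof eventually_elim
    case (elim n)
    \<comment> \<open>The second coefficient exceeds the first by this nonnegative amount, so it
      inherits the same lower bound.\<close>
    have "0 \<le> \<tau> (n + 1) / \<tau> (n + 2) * \<mu>" using tau_pos[of "n + 1"] tau_pos[of "n + 2"] \<mu>(1) by simp
    then have c2: "(\<psi> - \<mu>) / 2 \<le> \<psi> * (\<tau> (Suc n) / \<tau> n)" using elim(1) by simp
    have "E1 n \<le> (\<psi> * (\<tau> (Suc n) / \<tau> n) - \<tau> (Suc n) / \<tau> (n + 2) * \<mu>) * qform S (x (n + 2) - x (Suc n))"
      unfolding E1_def using elim(1) by (intro mult_right_mono qform_nonneg[OF S]) simp
    moreover have "E2 n \<le> \<psi> * (\<tau> (Suc n) / \<tau> n) * qform S (x (Suc n) - u (n + 2))"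
      unfolding E2_def using c2 by (intro mult_right_mono qform_nonneg[OF S])
    moreover have "E3 n \<le> \<tau> (Suc n) * qform T (w (Suc n) - w n)"
      unfolding E3_def by (intro mult_right_mono qform_nonneg[OF T] m(2))
    moreover have "E4 n \<le> (1 - \<tau> (Suc n) / \<tau> (n + 2) * \<mu>) / \<beta> * (norm (y (Suc n) - y n))\<^sup>2"
      unfolding E4_def using elim(2) \<beta> by (intro mult_right_mono divide_right_mono) auto
    ultimately show ?case using lyap_descent[OF sp, of n] unfolding E_def by linarith
  qed
  moreover have "0 \<le> E n" for n using nonneg by (simp add: E_def)
  ultimately have conv: "convergent (lyap a c d)" and E: "E \<longlonglongrightarrow> 0"
    using lyapunov[of "lyap a c d" E] lyap_nonneg by blast+
  show "convergent (lyap a c d)" by (rule conv)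
  have le: "E1 n \<le> E n" "E2 n \<le> E n" "E3 n \<le> E n" "E4 n \<le> E n" for n
    using nonneg[of n] by (simp_all add: E_def)
  show "(\<lambda>n. x (n + 2) - x (Suc n)) \<longlonglongrightarrow> 0"
    by (rule null_of_qform_bound[OF S _ le(1)[unfolded E1_def] E]) (use \<mu>\<psi> in simp)
  show "(\<lambda>n. x (Suc n) - u (n + 2)) \<longlonglongrightarrow> 0"
    by (rule null_of_qform_bound[OF S _ le(2)[unfolded E2_def] E]) (use \<mu>\<psi> in simp)
  show "(\<lambda>n. w (Suc n) - w n) \<longlonglongrightarrow> 0"
    by (rule null_of_qform_bound[OF T m(1) le(3)[unfolded E3_def] E])
  show "(\<lambda>n. y (Suc n) - y n) \<longlonglongrightarrow> 0"
    by (rule null_of_square_bound[OF _ le(4)[unfolded E4_def] E]) (use \<mu>1 \<beta> in simp)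
qed

section \<open>Boundedness, cluster points and convergence\<close>

text \<open>The three summands of \<open>lyap\<close> are nonnegative, so each inherits a bound of
  the sum; the positive lower bound of the step sizes removes the weight from the
  \<open>w\<close>-term.\<close>

lemma bounded_iterates:
  assumes "convergent (lyap a c d)"
  shows "bounded (range (\<lambda>n. u (n + 2)))" and "bounded (range w)" and "bounded (range y)"
proof -
  obtain m where m: "0 < m" "\<And>n. m \<le> \<tau> n" using tau_lower_bound by blast
  obtain K where K: "\<And>n. norm (lyap a c d n) \<le> K"
    using convergent_imp_Bseq[OF assms] by (auto simp: Bseq_def)
  have pos: "0 \<le> \<psi> / (\<psi> - 1) * qform S (u (n + 2) - a)" "0 \<le> \<tau> n * qform T (w n - c)"
    "0 \<le> (norm (y n - d))\<^sup>2 / \<beta>" for n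
    using \<psi> \<beta> tau_pos[of n] qform_nonneg[OF S] qform_nonneg[OF T] by simp_all
  have le: "\<psi> / (\<psi> - 1) * qform S (u (n + 2) - a) \<le> K" "\<tau> n * qform T (w n - c) \<le> K"
    "(norm (y n - d))\<^sup>2 / \<beta> \<le> K" for n
    using pos[of n] K[of n] by (simp_all add: lyap_def)
  show "bounded (range (\<lambda>n. u (n + 2)))"
    by (rule bounded_of_qform_bound[OF S _ le(1)]) (use \<psi> in simp)
  have "m * qform T (w n - c) \<le> K" for n
    using mult_right_mono[OF m(2) qform_nonneg[OF T]] le(2) by (rule order_trans)
  then show "bounded (range w)" by (rule bounded_of_qform_bound[OF T m(1)])
  show "bounded (range y)"
    by (rule bounded_of_square_bound[of "1 / \<beta>"]) (use \<beta> le(3) in auto)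
qed

text \<open>Vanishing increments give neighbouring indices the same limits along \<open>r\<close>.
  In the optimality conditions the proximal terms then tend to 0, and closed epigraphs allow passing
  to the limit.\<close>

lemma cluster_point_is_saddle:
  assumes r: "strict_mono r"
    and lim: "(\<lambda>n. u (r n + 2)) \<longlonglongrightarrow> xs" "(\<lambda>n. w (r n)) \<longlonglongrightarrow> ws" "(\<lambda>n. y (r n)) \<longlonglongrightarrow> ys"
    and dx: "(\<lambda>n. x (n + 2) - x (Suc n)) \<longlonglongrightarrow> 0" and du: "(\<lambda>n. x (Suc n) - u (n + 2)) \<longlonglongrightarrow> 0"
    and dw: "(\<lambda>n. w (Suc n) - w n) \<longlonglongrightarrow> 0" and dy: "(\<lambda>n. y (Suc n) - y n) \<longlonglongrightarrow> 0"
  shows "saddle_point g f A B b xs ws ys"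
proof -
  obtain t where t: "0 < t" "\<tau> \<longlonglongrightarrow> t" by (rule tau_limit)
  note sub = LIMSEQ_subseq_LIMSEQ[OF _ r, unfolded o_def]
  have x1: "(\<lambda>n. x (Suc (r n))) \<longlonglongrightarrow> xs" using tendsto_add[OF sub[OF du] lim(1)] by simp
  have x2: "(\<lambda>n. x (Suc (Suc (r n)))) \<longlonglongrightarrow> xs" using tendsto_add[OF sub[OF dx] x1] by simp
  have u2: "(\<lambda>n. u (Suc (Suc (r n)))) \<longlonglongrightarrow> xs" using lim(1) by simp
  have w1: "(\<lambda>n. w (Suc (r n))) \<longlonglongrightarrow> ws" using tendsto_add[OF sub[OF dw] lim(2)] by simp
  have y1: "(\<lambda>n. y (Suc (r n))) \<longlonglongrightarrow> ys" using tendsto_add[OF sub[OF dy] lim(3)] by simp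
  have t1: "(\<lambda>n. \<tau> (Suc (r n))) \<longlonglongrightarrow> t" using sub[OF LIMSEQ_Suc[OF t(2)]] .
  show ?thesis
  proof (rule saddle_pointI)
    \<comment> \<open>The residual is the multiplier increment divided by
      \<open>\<beta> * \<tau> (Suc n)\<close>; it vanishes in the limit because the step sizes stay
      away from 0.\<close>
    have "(\<lambda>n. (1 / (\<beta> * \<tau> (Suc (r n)))) *\<^sub>R (y (Suc (r n)) - y (r n))) \<longlonglongrightarrow> (1 / (\<beta> * t)) *\<^sub>R 0"
      using t(1) \<beta> by (intro tendsto_intros t1 sub[OF dy]) auto
    moreover have "(1 / (\<beta> * \<tau> (Suc n))) *\<^sub>R (y (Suc n) - y n) = A *v x (Suc n) + B *v w (Suc n) - b" for n
      using \<beta> tau_pos[of "Suc n"] unfolding y_step by simp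
    ultimately have "(\<lambda>n. A *v x (Suc (r n)) + B *v w (Suc (r n)) - b) \<longlonglongrightarrow> 0" by simp
    moreover have "(\<lambda>n. A *v x (Suc (r n)) + B *v w (Suc (r n)) - b) \<longlonglongrightarrow> A *v xs + B *v ws - b"
      by (intro tendsto_intros tendsto_matrix_vector_mult x1 w1)
    ultimately have "A *v xs + B *v ws - b = 0" using LIMSEQ_unique by blast
    then show "A *v xs + B *v ws = b" by simp
  next
    fix z
    have "(\<lambda>n. y (Suc (r n)) \<bullet> (A *v (z - x (Suc (Suc (r n)))))
        + (1 / \<tau> (Suc (r n))) * ((z - x (Suc (Suc (r n)))) \<bullet> (S *v (x (Suc (Suc (r n))) - u (Suc (Suc (r n)))))))
      \<longlonglongrightarrow> ys \<bullet> (A *v (z - xs)) + (1 / t) * ((z - xs) \<bullet> (S *v (xs - xs)))"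
      using t(1) by (intro tendsto_intros tendsto_matrix_vector_mult x2 u2 y1 t1) auto
    from epi_closed_limit[OF g x2 this g_ineq]
    show "g xs \<le> g z + ereal (ys \<bullet> (A *v (z - xs)))" by simp
  next
    fix z
    have "(\<lambda>n. y (Suc (r n)) \<bullet> (B *v (z - w (Suc (r n)))) + (z - w (Suc (r n))) \<bullet> (T *v (w (Suc (r n)) - w (r n))))
      \<longlonglongrightarrow> ys \<bullet> (B *v (z - ws)) + (z - ws) \<bullet> (T *v (ws - ws))"
      by (intro tendsto_intros tendsto_matrix_vector_mult w1 lim y1)
    from epi_closed_limit[OF f w1 this f_ineq]
    show "f ws \<le> f z + ereal (ys \<bullet> (B *v (z - ws)))" by simp
  qed
qed

lemma converges_to_saddle:
  assumes "saddle_point g f A B b xbar wbar ybar"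
  shows "\<exists>xs ws ys. saddle_point g f A B b xs ws ys \<and> (\<lambda>k. (x k, w k, y k)) \<longlonglongrightarrow> (xs, ws, ys)"
proof -
  note conv = lyap_convergence[OF assms]
  note bdd = bounded_iterates[OF conv(1)]
  have "bounded (range (\<lambda>n. (u (n + 2), w n, y n)))"
    by (rule bounded_subset[OF bounded_Times[OF bdd(1) bounded_Times[OF bdd(2,3)]]]) auto
  then obtain l r where r: "strict_mono (r :: nat \<Rightarrow> nat)" and l: "((\<lambda>n. (u (n + 2), w n, y n)) \<circ> r) \<longlonglongrightarrow> l"
    using bounded_imp_convergent_subsequence by blast
  obtain xs ws ys where l_eq: "l = (xs, ws, ys)" by (cases l)
  have lim: "(\<lambda>n. u (r n + 2)) \<longlonglongrightarrow> xs" "(\<lambda>n. w (r n)) \<longlonglongrightarrow> ws" "(\<lambda>n. y (r n)) \<longlonglongrightarrow> ys"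
    using tendsto_fst[OF l] tendsto_fst[OF tendsto_snd[OF l]] tendsto_snd[OF tendsto_snd[OF l]]
    by (simp_all add: l_eq o_def)
  have saddle: "saddle_point g f A B b xs ws ys"
    by (rule cluster_point_is_saddle[OF r lim conv(2-5)])
  obtain t where t: "0 < t" "\<tau> \<longlonglongrightarrow> t" by (rule tau_limit)
  obtain m where m: "0 < m" "\<And>n. m \<le> \<tau> n" using tau_lower_bound by blast
  note sub = LIMSEQ_subseq_LIMSEQ[OF _ r, unfolded o_def]
  \<comment> \<open>The Lyapunov function is now centred at the cluster point. It converges as a
    whole and tends to 0 along \<open>r\<close>, so its limit is 0.\<close>
  obtain L where L: "lyap xs ws ys \<longlonglongrightarrow> L"
    using lyap_convergence(1)[OF saddle] by (auto simp: convergent_def)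
  have "(\<lambda>n. lyap xs ws ys (r n)) \<longlonglongrightarrow> \<psi> / (\<psi> - 1) * qform S (xs - xs) + t * qform T (ws - ws) + (norm (ys - ys))\<^sup>2 / \<beta>"
    unfolding lyap_def using \<beta> by (intro tendsto_intros tendsto_matrix_vector_mult lim sub[OF t(2)]) auto
  then have "L = 0" using LIMSEQ_unique[OF sub[OF L]] by fastforce
  then have lyap0: "lyap xs ws ys \<longlonglongrightarrow> 0" using L by simp
  have pos: "0 \<le> \<psi> / (\<psi> - 1) * qform S (u (n + 2) - xs)" "0 \<le> \<tau> n * qform T (w n - ws)"
    "0 \<le> (norm (y n - ys))\<^sup>2 / \<beta>" for n
    using \<psi> \<beta> tau_pos[of n] qform_nonneg[OF S] qform_nonneg[OF T] by simp_all
  have le: "\<psi> / (\<psi> - 1) * qform S (u (n + 2) - xs) \<le> lyap xs ws ys n" "\<tau> n * qform T (w n - ws) \<le> lyap xs ws ys n"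
    "1 / \<beta> * (norm (y n - ys))\<^sup>2 \<le> lyap xs ws ys n" for n
    using pos[of n] by (simp_all add: lyap_def)
  have "(\<lambda>n. u (n + 2) - xs) \<longlonglongrightarrow> 0"
    by (rule null_of_qform_bound[OF S _ le(1) lyap0]) (use \<psi> in simp)
  \<comment> \<open>\<open>lyap\<close> controls \<open>u\<close> only; the vanishing of
    \<open>x (Suc n) - u (n + 2)\<close> carries the limit over to \<open>x\<close>.\<close>
  from tendsto_add[OF conv(3) this] have "(\<lambda>n. x (Suc n) - xs) \<longlonglongrightarrow> 0" by simp
  then have "(\<lambda>n. x (Suc n)) \<longlonglongrightarrow> xs" by (simp add: LIM_zero_iff)
  then have xl: "x \<longlonglongrightarrow> xs" by (rule LIMSEQ_imp_Suc)
  have "m * qform T (w n - ws) \<le> lyap xs ws ys n" for n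
    using mult_right_mono[OF m(2) qform_nonneg[OF T]] le(2) by (rule order_trans)
  then have "(\<lambda>n. w n - ws) \<longlonglongrightarrow> 0" by (rule null_of_qform_bound[OF T m(1) _ lyap0])
  then have wl: "w \<longlonglongrightarrow> ws" by (simp add: LIM_zero_iff)
  have "(\<lambda>n. y n - ys) \<longlonglongrightarrow> 0"
    by (rule null_of_square_bound[OF _ le(3) lyap0]) (use \<beta> in simp)
  then have yl: "y \<longlonglongrightarrow> ys" by (simp add: LIM_zero_iff)
  show ?thesis using saddle tendsto_Pair[OF xl tendsto_Pair[OF wl yl]] by blast
qed

end

theorem theorem4p1:
  fixes g :: "real^'q \<Rightarrow> ereal" and f :: "real^'p \<Rightarrow> ereal"
    and A :: "real^'q^'m" and B :: "real^'p^'m" and b :: "real^'m"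
    and S :: "real^'q^'q" and T :: "real^'p^'p"
    and \<beta> \<psi> \<mu> :: real
    and u x :: "nat \<Rightarrow> real^'q" and \<tau> :: "nat \<Rightarrow> real"
    and w :: "nat \<Rightarrow> real^'p" and y :: "nat \<Rightarrow> real^'m"
    and xbar :: "real^'q" and wbar :: "real^'p" and ybar :: "real^'m"
  assumes "proper_closed_convex g" and "proper_closed_convex f"
    and "standing_assumption g f A B b"
    and "saddle_point g f A B b xbar wbar ybar"
    and "sym_pos_def S" and "sym_pos_def T"
    and "\<tau> 0 > 0" and "\<beta> > 0"
    and "1 < \<psi>" and "\<psi> \<le> golden"
    and "0 < \<mu>" and "\<mu> < \<psi> / 2"
    and "algorithm1 g f A B b S T \<beta> \<psi> \<mu> u x \<tau> w y"
  shows "\<exists>xs ws ys. saddle_point g f A B b xs ws ys \<and>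
           (\<lambda>k. (x k, w k, y k)) \<longlonglongrightarrow> (xs, ws, ys)"
proof -
  interpret golden_ratio_admm g f A B b S T \<beta> \<psi> \<mu> u x \<tau> w y
    using assms by unfold_locales
  show ?thesis
    by (rule converges_to_saddle[OF assms(4)])
qed

end
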